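(* (a) For every anonymous monotonic mechanism $M$ and all integers $n,k$ with $1\le k<\frac n2$, there exists an instance of the strategic facility location game with $n$ clients, $k$ of them strategic, on which the worst Nash equilibrium under $M$ is a $\frac{n+2k-2}{n-2k+2}$ approximation of the true optimal solution, i.e., the price of anarchy of $M$ on this instance is $\frac{n+2k-2}{n-2k+2}$. (b) For $k\ge \frac n2$ the price of anarchy of every such mechanism is at least $\Omega(n)$ on some instances: there is an absolute constant $c>0$ such that for every anonymous monotonic mechanism $M$ and all integers $n,k$ with $\frac n2\le k\le n$, $k \geq 1$, there exists an instance with $n$ clients, $k$ of them strategic, on which the price of anarchy of $M$ is at least $c\,n$.
   Context: Setting. An instance consists of a metric space with distance $d$; a set $\mathcal{C}$ of $n$ clients, each having a true location in the metric space (several clients may share a location; the true location of client $i$ is also denoted $i$); a finite nonempty set $\mathcal{F}$ of possible facility locations in the metric space, equipped with a fixed total ordering (which may be used for tie-breaking); and a partition $\mathcal{C}=T\cup L$, $T\cap L=\emptyset$, with $|L|=k\ge 1$, $|T|=n-k$. Clients in $T$ always report their true location; each client $i\in L$ (strategic) may report any point $x_i$ of the metric space. Let $\vec t$ be the vector of true locations of clients in $T$ and $\vec x=(x_i)_{i\in L}$ the vector of reports of the strategic clients. A (deterministic) mechanism $M$ maps, for each metric space and facility set $\mathcal{F}$, every vector of $n$ reported locations to an element of $\mathcal{F}$; it knows only the reports, not which clients are strategic. $M$ is anonymous if its outcome does not depend on the identities of the clients (it is invariant under permuting the reports among clients). $M$ is monotonic if whenever $M$ outputs $A$ on a profile of reports,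 and any one client $i$ changes its report to the location $A$ (all other reports unchanged), then $M$ still outputs $A$. Nash equilibrium (NE) under $M$: a profile $(\vec t;\vec x)$ such that for every $i\in L$ and every point $x_i'$ of the metric space, $d(i,M(\vec t;\vec x_{-i},x_i'))\ge d(i,M(\vec t;\vec x))$, where $(\vec x_{-i},x_i')$ is $\vec x$ with $i$'s report replaced by $x_i'$. Price of anarchy: let $O\in\mathcal{F}$ minimize the true cost $\sum_{i\in\mathcal{C}}d(i,O)$, and let $S$ be the set of facilities $A$ such that some NE under $M$ selects $A$. The price of anarchy of $M$ on the instance is $\sup_{A\in S}\frac{\sum_{i\in\mathcal{C}}d(i,A)}{\sum_{i\in\mathcal{C}}d(i,O)}$. *)

theory Defs
  imports "HOL-Analysis.Analysis" "HOL-Combinatorics.Permutations"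
begin

(* The type variable 'p is a universe of points: a metric space is an element of the library type
   'p metric, with carrier "mspace X", a subset of 'p, and distance "mdist X".  Thus one mechanism
   handles all metric spaces with points in 'p, all facility sets, all orders on them, and all
   numbers of clients (a vector of n reports is a list of length n, and client i is the index i). *)

type_synonym 'p mechanism =
  "'p metric \<Rightarrow> 'p set \<Rightarrow> ('p \<times> 'p) set \<Rightarrow> 'p list \<Rightarrow> 'p"

definition facility_setting :: "'p metric \<Rightarrow> 'p set \<Rightarrow> ('p \<times> 'p) set \<Rightarrow> bool" where
  "facility_setting X F r \<longleftrightarrow>
     finite F \<and> F \<noteq> {} \<and> F \<subseteq> mspace X \<and> linear_order_on F r"

definition mechanism :: "'p mechanism \<Rightarrow> bool" where
  "mechanism M \<longleftrightarrow>
     (\<forall>X F r xs. facility_setting X F r \<and> set xs \<subseteq> mspace X \<longrightarrow> M X F r xs \<in> F)"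

definition anonymous :: "'p mechanism \<Rightarrow> bool" where
  "anonymous M \<longleftrightarrow>
     (\<forall>X F r xs \<pi>. facility_setting X F r \<and> set xs \<subseteq> mspace X \<and> \<pi> permutes {..<length xs} \<longrightarrow>
        M X F r (permute_list \<pi> xs) = M X F r xs)"

definition monotonic :: "'p mechanism \<Rightarrow> bool" where
  "monotonic M \<longleftrightarrow>
     (\<forall>X F r xs i. facility_setting X F r \<and> set xs \<subseteq> mspace X \<and> i < length xs \<longrightarrow>
        M X F r (xs[i := M X F r xs]) = M X F r xs)"

record 'p game =
  game_space :: "'p metric"
  facilities :: "'p set"
  facility_order :: "('p \<times> 'p) set"
  true_locs :: "'p list"
  strategic :: "nat set"

definition num_clients :: "'p game \<Rightarrow> nat" where
  "num_clients G = length (true_locs G)"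

definition valid_game :: "'p game \<Rightarrow> bool" where
  "valid_game G \<longleftrightarrow>
     facility_setting (game_space G) (facilities G) (facility_order G) \<and>
     set (true_locs G) \<subseteq> mspace (game_space G) \<and>
     strategic G \<subseteq> {..<num_clients G} \<and> strategic G \<noteq> {}"

definition outcome :: "'p mechanism \<Rightarrow> 'p game \<Rightarrow> 'p list \<Rightarrow> 'p" where
  "outcome M G xs = M (game_space G) (facilities G) (facility_order G) xs"

definition report_profile :: "'p game \<Rightarrow> 'p list \<Rightarrow> bool" where
  "report_profile G xs \<longleftrightarrow>
     length xs = num_clients G \<and> set xs \<subseteq> mspace (game_space G) \<and>
     (\<forall>i \<in> {..<num_clients G} - strategic G. xs ! i = true_locs G ! i)"

definition nash_equilibrium :: "'p mechanism \<Rightarrow> 'p game \<Rightarrow> 'p list \<Rightarrow> bool" where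
  "nash_equilibrium M G xs \<longleftrightarrow>
     report_profile G xs \<and>
     (\<forall>i \<in> strategic G. \<forall>y \<in> mspace (game_space G).
        mdist (game_space G) (true_locs G ! i) (outcome M G (xs[i := y]))
          \<ge> mdist (game_space G) (true_locs G ! i) (outcome M G xs))"

definition true_cost :: "'p game \<Rightarrow> 'p \<Rightarrow> real" where
  "true_cost G A = (\<Sum>i<num_clients G. mdist (game_space G) (true_locs G ! i) A)"

definition optimal_facility :: "'p game \<Rightarrow> 'p" where
  "optimal_facility G = arg_min_on (true_cost G) (facilities G)"

definition ne_outcomes :: "'p mechanism \<Rightarrow> 'p game \<Rightarrow> 'p set" where
  "ne_outcomes M G = {A. \<exists>xs. nash_equilibrium M G xs \<and> outcome M G xs = A}"

(* Extended reals: a positive cost divided by an optimal cost 0 is \<infinity>, whereas 0/0 = 0 here, and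
   the supremum is -\<infinity> if there is no equilibrium.  So a value in the open interval from 0 to \<infinity>
   forces an equilibrium to exist and the optimal cost to be positive. *)
definition price_of_anarchy :: "'p mechanism \<Rightarrow> 'p game \<Rightarrow> ereal" where
  "price_of_anarchy M G =
     (SUP A \<in> ne_outcomes M G.
        ereal (true_cost G A) / ereal (true_cost G (optimal_facility G)))"

end

theory Submission
  imports Defs
begin

text \<open>
  Two facilities lie at distance 2, and every other point is at distance 1 from both. On a profile
  with equally many reports at the two facilities, plus one report elsewhere if the number of
  clients is odd, the mechanism selects one of them, say \<open>P\<close>. If the strategic clients
  located at the other facility \<open>Q\<close> all report \<open>P\<close>, so that \<open>P\<close> has more reports than in the
  balanced profile, then no single deviation makes \<open>Q\<close> win: otherwise \<open>Q\<close> would also win when the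
  deviator reports \<open>Q\<close>, although monotonicity starting from the balanced profile yields \<open>P\<close>.
\<close>

definition pole_dist :: "'p \<Rightarrow> 'p \<Rightarrow> 'p \<Rightarrow> 'p \<Rightarrow> real" where
  "pole_dist P Q x y = (if x = y then 0 else if {x, y} = {P, Q} then 2 else 1)"

text \<open>The carrier is the whole type, so every list of points is an admissible report
  vector.\<close>

definition pole_space :: "'p \<Rightarrow> 'p \<Rightarrow> 'p metric" where
  "pole_space P Q = metric (UNIV, pole_dist P Q)"

text \<open>Nonzero distances are all 1 or 2, so the triangle inequality cannot fail.\<close>

lemma Metric_space_pole_dist: "Metric_space UNIV (pole_dist P Q)"
  by unfold_locales (auto simp: pole_dist_def insert_commute)

lemma mspace_pole_space [simp]: "mspace (pole_space P Q) = UNIV"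
  and mdist_pole_space [simp]: "mdist (pole_space P Q) = pole_dist P Q"
  by (simp_all add: pole_space_def Metric_space_pole_dist Metric_space.mspace_metric
      Metric_space.mdist_metric)

text \<open>Used to exchange the roles of the facilities: \<open>M\<close> takes the space as an
  argument, so equality is required, not just an isometry.\<close>

lemma pole_space_commute: "pole_space P Q = pole_space Q P"
proof -
  have "pole_dist P Q = pole_dist Q P"
    by (simp add: pole_dist_def insert_commute fun_eq_iff)
  then show ?thesis
    by (simp add: pole_space_def)
qed

text \<open>Lists with equal multisets differ by a permutation, so profiles can be compared by
  counting reports.\<close>

lemma anonymous_mset_eq:
  assumes "anonymous M" "facility_setting X F r" "set xs \<subseteq> mspace X" "mset ys = mset xs"
  shows "M X F r ys = M X F r xs"
proof -
  obtain \<pi> where "\<pi> permutes {..<length xs}" "permute_list \<pi> xs = ys"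
    using mset_eq_permutation[OF assms(4)] by blast
  then show ?thesis
    using assms(1-3) unfolding anonymous_def by blast
qed

lemma monotonic_list_update:
  assumes "monotonic M" "facility_setting X F r" "set xs \<subseteq> mspace X" "M X F r xs = A"
  shows "M X F r (xs[i := A]) = A"
  using assms unfolding monotonic_def by (cases "i < length xs") (auto simp: list_update_beyond)

text \<open>Monotonicity is applied to one report at a time; \<open>us\<close> is generalized
  because it absorbs the entries already changed.\<close>

lemma monotonic_replicate:
  assumes M: "monotonic M" and X: "facility_setting X F r"
    and "set us \<subseteq> mspace X" "set ws \<subseteq> mspace X" "set vs \<subseteq> mspace X" "A \<in> mspace X"
    and "M X F r (us @ vs @ ws) = A"
  shows "M X F r (us @ replicate (length vs) A @ ws) = A"
  using assms(3-)
proof (induction vs arbitrary: us)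
  case (Cons v vs)
  have "M X F r ((us @ v # vs @ ws)[length us := A]) = A"
    using Cons.prems by (intro monotonic_list_update[OF M X]) auto
  then have "M X F r ((us @ [A]) @ vs @ ws) = A"
    by simp
  from Cons.IH[OF _ _ _ _ this] Cons.prems show ?case
    by simp
qed simp

lemma replicate_mset_plus:
  "replicate_mset (m + n) x = replicate_mset m x + replicate_mset n x"
  by (induction m) auto

text \<open>Here \<open>b\<close>, \<open>a\<close>, \<open>e\<close> count the clients truly at
  \<open>Q\<close>, \<open>P\<close>, \<open>C\<close>. By \<open>majority\<close>, \<open>P\<close>
  gets more than \<open>h\<close> reports once the strategic clients at \<open>Q\<close> report
  \<open>P\<close>; \<open>0 < a + e\<close> keeps the optimal cost positive.\<close>

lemma pole_game_price_of_anarchy: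
  fixes M :: "'p mechanism" and a b e h k :: nat
  assumes mech: "mechanism M" and anon: "anonymous M" and mono: "monotonic M"
    and dist: "P \<noteq> Q" "C \<noteq> P" "C \<noteq> Q"
    and r: "linear_order_on {P, Q} r"
    and balanced:
      "M (pole_space P Q) {P, Q} r (replicate h P @ replicate h Q @ replicate e C) = P"
    and ab: "a + b = 2 * h" "a \<le> b" "0 < a + e"
    and k: "1 \<le> k" "k \<le> a + b + e"
    and majority: "b = 0 \<or> h < a + min k b"
  shows "\<exists>G :: 'p game. valid_game G \<and> num_clients G = a + b + e \<and> card (strategic G) = k \<and>
           0 < true_cost G (optimal_facility G) \<and>
           price_of_anarchy M G = ereal ((2 * real b + real e) / (2 * real a + real e))"
proof -
  define X where "X = pole_space P Q"
  define F where "F = {P, Q}"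
  \<comment> \<open>The strategic clients are the first \<open>k\<close>, and the \<open>Q\<close>
    block opens \<open>ts\<close>, so \<open>s\<close> counts the strategic clients at
    \<open>Q\<close>.\<close>
  define s where "s = min k b"
  define ts where "ts = replicate b Q @ replicate a P @ replicate e C"
  define xs where "xs = replicate s P @ replicate (b - s) Q @ replicate a P @ replicate e C"
  define G where "G = \<lparr>game_space = X, facilities = F, facility_order = r, true_locs = ts,
                       strategic = {..<k}\<rparr>"
  have X [simp]: "mspace X = UNIV" "mdist X = pole_dist P Q"
    by (simp_all add: X_def)
  have setting: "facility_setting X F r"
    using r by (auto simp: facility_setting_def F_def)
  have G [simp]: "game_space G = X" "facilities G = F" "facility_order G = r"
      "true_locs G = ts" "strategic G = {..<k}" "num_clients G = a + b + e"
      and out [simp]: "outcome M G = M X F r"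
    by (auto simp: G_def num_clients_def ts_def outcome_def)
  have in_F: "M X F r ys \<in> F" for ys
    using mech setting unfolding mechanism_def by simp
  have anon': "M X F r ys = M X F r zs" if "mset ys = mset zs" for ys zs
    using anonymous_mset_eq[OF anon setting _ that] by simp
  have len [simp]: "length xs = a + b + e" "length ts = a + b + e"
    by (simp_all add: xs_def ts_def s_def)

  have deviation: "M X F r (xs[i := y]) = P" if i: "i < s" for i y
  proof (rule ccontr)
    assume "M X F r (xs[i := y]) \<noteq> P"
    then have "M X F r (xs[i := y]) = Q"
      using in_F[of "xs[i := y]"] by (auto simp: F_def)
    then have "M X F r ((xs[i := y])[i := Q]) = Q"
      by (intro monotonic_list_update[OF mono setting]) auto
    \<comment> \<open>After the deviator reports \<open>Q\<close>, exactly
      \<open>a + s - 1 = h + j\<close> reports at \<open>P\<close> remain: \<open>j\<close> reports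
      more than in the balanced profile, possibly none.\<close>
    moreover obtain j where j: "a + s = Suc (h + j)"
      using majority i by (auto simp: s_def less_iff_Suc_add)
    obtain s' where s': "s = Suc s'"
      using i by (cases s) auto
    have "M X F r (replicate h P @ replicate j Q @ (replicate (h - j) Q @ replicate e C)) = P"
    proof -
      have "j \<le> h" using j ab by (auto simp: s_def)
      then have "replicate h Q = replicate j Q @ replicate (h - j) Q"
        by (simp flip: replicate_add)
      then show ?thesis
        using balanced by (simp add: X_def F_def)
    qed
    then have "M X F r (replicate h P @ replicate j P @ (replicate (h - j) Q @ replicate e C)) = P"
      using monotonic_replicate[OF mono setting, of "replicate h P" _ "replicate j Q" P] by simp
    moreover have "mset (xs[i := Q])
        = mset (replicate h P @ replicate j P @ (replicate (h - j) Q @ replicate e C))"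
    proof -
      have "b - s + 1 = h - j"
        using j ab s' by (simp add: s_def)
      then have 1: "add_mset Q (replicate_mset (b - s) Q) = replicate_mset (h - j) Q"
        by (metis Suc_eq_plus1 replicate_mset_Suc)
      have "s' + a = h + j"
        using j s' by simp
      then have 2: "replicate_mset s' P + replicate_mset a P = replicate_mset (h + j) P"
        by (metis replicate_mset_plus)
      have "xs ! i = P"
        using i by (simp add: xs_def nth_append)
      moreover have "i < length xs"
        using i by (simp add: s_def)
      moreover have "mset xs = add_mset P (replicate_mset (h + j) P + replicate_mset (b - s) Q
          + replicate_mset e C)"
        by (simp add: xs_def s' flip: 2)
      ultimately show ?thesis
        by (simp add: mset_update replicate_mset_plus flip: 1)
    qed
    ultimately show False
      using anon' dist by fastforce
  qed
  have P: "M X F r xs = P"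
  proof (cases "b = 0")
    case True
    \<comment> \<open>Here \<open>a \<le> b\<close> forces \<open>a = h = 0\<close>, so
      \<open>xs\<close> is itself the balanced profile.\<close>
    then show ?thesis
      using balanced ab by (simp add: xs_def s_def X_def F_def)
  next
    case False
    then have "0 < s" using k by (simp add: s_def)
    \<comment> \<open>Client 0 already reports \<open>P\<close>, so \<open>xs\<close> is a trivial
      deviation from itself and \<open>deviation\<close> applies.\<close>
    then have "xs[0 := P] = xs"
      by (simp add: xs_def list_update_append) (cases s; simp)
    then show ?thesis
      using deviation[OF \<open>0 < s\<close>, of P] by simp
  qed

  have "nash_equilibrium M G xs"
    unfolding nash_equilibrium_def
  proof (intro conjI ballI)
    show "report_profile G xs"
      by (auto simp: report_profile_def xs_def ts_def nth_append s_def)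
  next
    fix i y assume i: "i \<in> strategic G"
    show "mdist (game_space G) (true_locs G ! i) (outcome M G xs)
        \<le> mdist (game_space G) (true_locs G ! i) (outcome M G (xs[i := y]))"
    proof (cases "i < b")
      case True
      then show ?thesis
        using i deviation[of i y] P by (simp add: s_def)
    next
      case False
      \<comment> \<open>A client at \<open>P\<close> already has distance 0, and one at
        \<open>C\<close> is indifferent between the facilities.\<close>
      then have "ts ! i = P \<or> ts ! i = C"
        using i k by (auto simp: ts_def nth_append)
      then show ?thesis
        using in_F[of "xs[i := y]"] P dist by (auto simp: F_def pole_dist_def doubleton_eq_iff)
    qed
  qed
  then have P_in: "P \<in> ne_outcomes M G"
    using P by (force simp: ne_outcomes_def)

  have cost: "true_cost G A = (\<Sum>x\<leftarrow>ts. pole_dist P Q x A)" for A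
    by (simp add: true_cost_def sum_list_sum_nth atLeast0LessThan)
  have cost_P: "true_cost G P = 2 * real b + real e" and cost_Q: "true_cost G Q = 2 * real a + real e"
    using dist
    by (auto simp: cost ts_def sum_list_replicate pole_dist_def doubleton_eq_iff)
  \<comment> \<open>Since \<open>a \<le> b\<close>, \<open>Q\<close> is optimal; in a tie
    \<open>P\<close> may be chosen instead, at the same cost.\<close>
  have opt: "true_cost G (optimal_facility G) = 2 * real a + real e"
    using arg_min_if_finite[of F "true_cost G"] cost_P cost_Q ab
    by (auto simp: F_def optimal_facility_def)
  have "price_of_anarchy M G = ereal ((2 * real b + real e) / (2 * real a + real e))"
    unfolding price_of_anarchy_def opt
  proof (rule antisym)
    show "(SUP A\<in>ne_outcomes M G. ereal (true_cost G A) / ereal (2 * real a + real e))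
        \<le> ereal ((2 * real b + real e) / (2 * real a + real e))"
    proof (rule SUP_least)
      fix A assume "A \<in> ne_outcomes M G"
      then have "A \<in> F"
        using in_F by (auto simp: ne_outcomes_def)
      then show "ereal (true_cost G A) / ereal (2 * real a + real e)
          \<le> ereal ((2 * real b + real e) / (2 * real a + real e))"
        using ab cost_P cost_Q by (auto simp: F_def intro!: divide_right_mono)
    qed
    show "ereal ((2 * real b + real e) / (2 * real a + real e))
        \<le> (SUP A\<in>ne_outcomes M G. ereal (true_cost G A) / ereal (2 * real a + real e))"
      by (rule SUP_upper2[OF P_in]) (use ab cost_P in auto)
  qed
  moreover have "valid_game G"
    using setting k by (auto simp: valid_game_def lessThan_empty_iff)
  ultimately show ?thesis
    using opt ab by (intro exI[of _ G]) auto
qed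

text \<open>Removes the \<open>balanced\<close> hypothesis: the winner of the balanced profile,
  whichever it is, takes the role of \<open>P\<close>.\<close>

lemma exists_game_price_of_anarchy:
  fixes M :: "'p mechanism" and a b k n :: nat
  assumes inf: "infinite (UNIV :: 'p set)"
    and M: "mechanism M" "anonymous M" "monotonic M"
    and ab: "a + b = 2 * (n div 2)" "a \<le> b" "0 < a + n mod 2"
    and k: "1 \<le> k" "k \<le> n" "b = 0 \<or> n div 2 < a + min k b"
  shows "\<exists>G :: 'p game. valid_game G \<and> num_clients G = n \<and> card (strategic G) = k \<and>
           0 < true_cost G (optimal_facility G) \<and>
           price_of_anarchy M G
             = ereal ((2 * real b + real (n mod 2)) / (2 * real a + real (n mod 2)))"
proof -
  define h e where "h = n div 2" and "e = n mod 2"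
  have n: "n = a + b + e"
    using ab by (simp add: e_def)
  have prems: "a + b = 2 * h" "a \<le> b" "0 < a + e" "1 \<le> k" "k \<le> a + b + e"
      "b = 0 \<or> h < a + min k b"
    using ab k n unfolding h_def e_def by argo+
  obtain T :: "'p set" where "card T = 3"
    using infinite_arbitrarily_large[OF inf] by blast
  then obtain P Q C :: 'p where dist: "P \<noteq> Q" "C \<noteq> P" "C \<noteq> Q"
    by (auto simp: card_3_iff)
  obtain r where "well_order_on {P, Q} r"
    using well_order_on by blast
  then have r: "linear_order_on {P, Q} r"
    by (simp add: well_order_on_def)
  let ?m = "M (pole_space P Q) {P, Q} r"
  have setting: "facility_setting (pole_space P Q) {P, Q} r"
    using r by (auto simp: facility_setting_def)
  have swap: "?m (replicate h Q @ replicate h P @ replicate e C)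
      = ?m (replicate h P @ replicate h Q @ replicate e C)"
    by (rule anonymous_mset_eq[OF M(2) setting]) auto
  have "?m (replicate h P @ replicate h Q @ replicate e C) \<in> {P, Q}"
    using M(1) setting unfolding mechanism_def by (metis mspace_pole_space subset_UNIV)
  \<comment> \<open>The second case is the first with \<open>P\<close> and \<open>Q\<close>
    exchanged; anonymity lets the two report blocks be reordered.\<close>
  then consider "?m (replicate h P @ replicate h Q @ replicate e C) = P"
    | "M (pole_space Q P) {Q, P} r (replicate h Q @ replicate h P @ replicate e C) = Q"
    using swap by (auto simp: pole_space_commute[of Q P] insert_commute)
  then show ?thesis
  proof cases
    case 1
    from pole_game_price_of_anarchy[OF M dist r 1 prems, folded n] show ?thesis
      unfolding e_def .
  next
    case 2
    have "linear_order_on {Q, P} r"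
      using r by (simp add: insert_commute)
    from pole_game_price_of_anarchy[OF M dist(1)[symmetric] dist(3,2) this 2 prems, folded n]
    show ?thesis
      unfolding e_def .
  qed
qed

theorem theorem3p7:
  assumes "infinite (UNIV :: 'p set)"
  shows
    "(\<forall>(M :: 'p mechanism) (n :: nat) (k :: nat).
        mechanism M \<and> anonymous M \<and> monotonic M \<and> 1 \<le> k \<and> real k < real n / 2 \<longrightarrow>
        (\<exists>G :: 'p game. valid_game G \<and> num_clients G = n \<and> card (strategic G) = k \<and>
           price_of_anarchy M G =
             ereal ((real n + 2 * real k - 2) / (real n - 2 * real k + 2))))
     \<and>
     (\<exists>c :: real. c > 0 \<and>
        (\<forall>(M :: 'p mechanism) (n :: nat) (k :: nat).
           mechanism M \<and> anonymous M \<and> monotonic M \<and>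
           real n / 2 \<le> real k \<and> k \<le> n \<and> 1 \<le> k \<longrightarrow>
           (\<exists>G :: 'p game. valid_game G \<and> num_clients G = n \<and> card (strategic G) = k \<and>
              0 < true_cost G (optimal_facility G) \<and>
              price_of_anarchy M G \<ge> ereal (c * real n))))"
proof (intro conjI allI impI)
  fix M :: "'p mechanism" and n k :: nat
  assume asm: "mechanism M \<and> anonymous M \<and> monotonic M \<and> 1 \<le> k \<and> real k < real n / 2"
  define h e where "h = n div 2" and "e = n mod 2"
  have n: "n = 2 * h + e"
    by (simp add: h_def e_def)
  have k: "1 \<le> k" "k \<le> h" "h - k + 1 \<le> h + k - 1"
    using asm by (auto simp: h_def)
  \<comment> \<open>With \<open>a = h - k + 1\<close> the winner gets \<open>a + k = h + 1\<close>
    reports, just enough for \<open>majority\<close>; a smaller \<open>a\<close> would violate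
    it.\<close>
  have "(2 * real (h + k - 1) + real e) / (2 * real (h - k + 1) + real e)
      = (real n + 2 * real k - 2) / (real n - 2 * real k + 2)"
    using k by (simp add: n of_nat_diff algebra_simps)
  with exists_game_price_of_anarchy[OF assms, of M "h - k + 1" "h + k - 1" n k] asm k
  show "\<exists>G :: 'p game. valid_game G \<and> num_clients G = n \<and> card (strategic G) = k \<and>
      price_of_anarchy M G = ereal ((real n + 2 * real k - 2) / (real n - 2 * real k + 2))"
    unfolding h_def[symmetric] e_def[symmetric] by auto
next
  have "\<exists>G :: 'p game. valid_game G \<and> num_clients G = n \<and> card (strategic G) = k \<and>
      0 < true_cost G (optimal_facility G) \<and> price_of_anarchy M G \<ge> ereal (1 / 2 * real n)"
    if asm: "mechanism M \<and> anonymous M \<and> monotonic M \<and> real n / 2 \<le> real k \<and> k \<le> n \<and> 1 \<le> k"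
    for M :: "'p mechanism" and n k :: nat
  proof -
    define h e where "h = n div 2" and "e = n mod 2"
    have n: "n = 2 * h + e" and e: "e = 0 \<or> e = 1"
      by (auto simp: h_def e_def)
    have k: "n \<le> 2 * k" "k \<le> n" "1 \<le> k"
      using asm by auto
    \<comment> \<open>Now a single client is away from \<open>Q\<close>: at \<open>P\<close> for
      even \<open>n\<close>, at \<open>C\<close> for odd \<open>n\<close>. The ratio is
      \<open>n - 1\<close> or \<open>2 * n - 1\<close> respectively, and \<open>n = 2\<close>
      attains the bound \<open>n / 2\<close>.\<close>
    have "1 / 2 * real n \<le> (2 * real (n - 1) + real e) / (2 * real (1 - e) + real e)"
      using e k n by (auto simp: of_nat_diff)
    moreover have "1 - e + (n - 1) = 2 * h" "1 - e \<le> n - 1" "0 < 1 - e + e"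
        "n - 1 = 0 \<or> h < 1 - e + min k (n - 1)"
      using e k n by (auto, arith)
    ultimately show ?thesis
      using exists_game_price_of_anarchy[OF assms, of M "1 - e" "n - 1" n k] asm
      unfolding h_def[symmetric] e_def[symmetric] by (metis ereal_less_eq(3))
  qed
  then show "\<exists>c :: real. c > 0 \<and>
      (\<forall>(M :: 'p mechanism) (n :: nat) (k :: nat).
         mechanism M \<and> anonymous M \<and> monotonic M \<and>
         real n / 2 \<le> real k \<and> k \<le> n \<and> 1 \<le> k \<longrightarrow>
         (\<exists>G :: 'p game. valid_game G \<and> num_clients G = n \<and> card (strategic G) = k \<and>
            0 < true_cost G (optimal_facility G) \<and>
            price_of_anarchy M G \<ge> ereal (c * real n)))"
    by (intro exI[of _ "1 / 2"]) auto
qed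

end
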